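(* If $\Gamma$ is a simple cubic girth-regular graph of girth $g$ with signature $(0,1,1)$, then $\Gamma\cong\mathrm{Tr}(\Lambda,\leftrightarrow)$ for some $g$-regular graph $\Lambda$ (possibly with parallel edges) and some dihedral scheme $\leftrightarrow$ on $\Lambda$. Moreover, if $\Gamma$ is vertex-transitive, then the dihedral scheme $\leftrightarrow$ can be taken to be arc-transitive.
   Context: Cubic means $3$-regular. For a graph of finite girth $g$, a girth cycle is a cycle of length $g$, and $\epsilon(e)$ is the number of girth cycles containing the edge $e$. The signature of a vertex $v$ with incident edges $e_1,\ldots,e_k$ ordered so that $\epsilon(e_1)\le\cdots\le\epsilon(e_k)$ is $(\epsilon(e_1),\ldots,\epsilon(e_k))$; a graph is girth-regular if all vertices have the same signature (the signature of the graph). A graph with parallel edges and loops is a triple $(V,E,\partial)$ with $\partial:E\to\{X\subseteq V:|X|\le 2\}$ giving the end-vertices of each edge. Each edge consists of two mutually inverse arcs, each having one end-vertex as its tail; $A(\Lambda)$ is the set of arcs and $\mathrm{out}(u)$ the set of arcs with tail $u$. A dihedral scheme on $\Lambda$ is an irreflexive symmetric relation $\leftrightarrow$ on $A(\Lambda)$ such that the simple graph $(A(\Lambda),\leftrightarrow)$ is $2$-regular and its connected components are exactly the sets $\mathrm{out}(u)$. The truncation $\mathrm{Tr}(\Lambda,\leftrightarrow)$ is the simple graph with vertex set $A(\Lambda)$ in which arcs $s,t$ are adjacent iff $s\leftrightarrow t$ or $s,t$ are mutually inverse. The scheme is arc-transitive if the group of automorphisms of $\Lambda$ preserving $\leftrightarrow$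 is transitive on $A(\Lambda)$. *)

theory Defs
  imports "HOL-Library.Extended_Nat" "HOL-Library.Multiset"
begin

subsection \<open>Simple graphs\<close>

text \<open>Neither finiteness nor connectedness is part of the notion of a simple graph.\<close>

record 'a sgraph =
  verts :: "'a set"
  edges :: "'a set set"

definition simple_graph :: "'a sgraph \<Rightarrow> bool" where
  "simple_graph G \<longleftrightarrow> (\<forall>e\<in>edges G. e \<subseteq> verts G \<and> card e = 2)"

definition incident_edges :: "'a sgraph \<Rightarrow> 'a \<Rightarrow> 'a set set" where
  "incident_edges G v = {e \<in> edges G. v \<in> e}"

text \<open>The finiteness clause matters for \<^term>\<open>k = 0\<close> only, where
  \<^const>\<open>card\<close> alone would admit vertices of infinite valence.\<close>

definition regular :: "nat \<Rightarrow> 'a sgraph \<Rightarrow> bool" where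
  "regular k G \<longleftrightarrow> (\<forall>v\<in>verts G. finite (incident_edges G v) \<and> card (incident_edges G v) = k)"

abbreviation cubic :: "'a sgraph \<Rightarrow> bool" where
  "cubic \<equiv> regular 3"

definition graph_iso :: "'a sgraph \<Rightarrow> 'b sgraph \<Rightarrow> ('a \<Rightarrow> 'b) \<Rightarrow> bool" where
  "graph_iso G H f \<longleftrightarrow> bij_betw f (verts G) (verts H) \<and>
     (\<forall>u\<in>verts G. \<forall>v\<in>verts G. {u, v} \<in> edges G \<longleftrightarrow> {f u, f v} \<in> edges H)"

definition isomorphic :: "'a sgraph \<Rightarrow> 'b sgraph \<Rightarrow> bool" where
  "isomorphic G H \<longleftrightarrow> (\<exists>f. graph_iso G H f)"

definition vertex_transitive :: "'a sgraph \<Rightarrow> bool" where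
  "vertex_transitive G \<longleftrightarrow> (\<forall>u\<in>verts G. \<forall>v\<in>verts G. \<exists>f. graph_iso G G f \<and> f u = v)"

definition component :: "'a sgraph \<Rightarrow> 'a \<Rightarrow> 'a set" where
  "component G v = {w \<in> verts G. (v, w) \<in> {(x, y). {x, y} \<in> edges G}\<^sup>*}"

definition components :: "'a sgraph \<Rightarrow> 'a set set" where
  "components G = component G ` verts G"

subsection \<open>Girth and signatures\<close>

text \<open>A cycle is a subgraph, not a rooted or oriented closed walk; it is identified with its set of
  edges \<^term>\<open>C\<close>, so its length is \<^term>\<open>card C\<close>.\<close>

definition is_cycle :: "'a sgraph \<Rightarrow> 'a set set \<Rightarrow> bool" where
  "is_cycle G C \<longleftrightarrow> C \<subseteq> edges G \<and>
     (\<exists>vs. distinct vs \<and> 3 \<le> length vs \<and> set vs \<subseteq> verts G \<and>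
        C = {{vs ! i, vs ! (Suc i mod length vs)} | i. i < length vs})"

definition girth :: "'a sgraph \<Rightarrow> enat" where
  "girth G = (INF C\<in>{C. is_cycle G C}. enat (card C))"

definition girth_cycle :: "'a sgraph \<Rightarrow> 'a set set \<Rightarrow> bool" where
  "girth_cycle G C \<longleftrightarrow> is_cycle G C \<and> enat (card C) = girth G"

text \<open>In a regular graph only finitely many girth cycles contain a given edge, so the value 0
  really means that there are none.\<close>

definition eps :: "'a sgraph \<Rightarrow> 'a set \<Rightarrow> nat" where
  "eps G e = card {C. girth_cycle G C \<and> e \<in> C}"

definition vertex_signature :: "'a sgraph \<Rightarrow> 'a \<Rightarrow> nat list" where
  "vertex_signature G v =
     sorted_list_of_multiset (image_mset (eps G) (mset_set (incident_edges G v)))"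

definition girth_regular :: "'a sgraph \<Rightarrow> bool" where
  "girth_regular G \<longleftrightarrow> girth G \<noteq> \<infinity> \<and>
     (\<forall>u\<in>verts G. \<forall>v\<in>verts G. vertex_signature G u = vertex_signature G v)"

definition has_signature :: "'a sgraph \<Rightarrow> nat list \<Rightarrow> bool" where
  "has_signature G s \<longleftrightarrow> (\<forall>v\<in>verts G. vertex_signature G v = s)"

subsection \<open>Graphs with parallel edges and loops\<close>

record ('v, 'e) multigraph =
  mverts :: "'v set"
  medges :: "'e set"
  ends :: "'e \<Rightarrow> 'v set"

text \<open>Every edge has at least one end-vertex, since each of its arcs has a tail.\<close>

definition multigraph :: "('v, 'e) multigraph \<Rightarrow> bool" where
  "multigraph L \<longleftrightarrow> (\<forall>e\<in>medges L. ends L e \<subseteq> mverts L \<and> card (ends L e) \<in> {1, 2})"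

definition loopless :: "('v, 'e) multigraph \<Rightarrow> bool" where
  "loopless L \<longleftrightarrow> (\<forall>e\<in>medges L. card (ends L e) \<noteq> 1)"

text \<open>An arc is an edge together with its tail and a tag. A non-loop \<^term>\<open>e\<close> with ends
  \<^term>\<open>u\<close>, \<^term>\<open>v\<close> has the arcs \<^term>\<open>(e, u, False)\<close> and \<^term>\<open>(e, v, False)\<close>; a loop at
  \<^term>\<open>u\<close> has the arcs \<^term>\<open>(e, u, False)\<close> and \<^term>\<open>(e, u, True)\<close>.\<close>

type_synonym ('v, 'e) arc = "'e \<times> 'v \<times> bool"

definition arc_edge :: "('v, 'e) arc \<Rightarrow> 'e" where
  "arc_edge a = fst a"

definition arc_tail :: "('v, 'e) arc \<Rightarrow> 'v" where
  "arc_tail a = fst (snd a)"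

definition arcs :: "('v, 'e) multigraph \<Rightarrow> ('v, 'e) arc set" where
  "arcs L = {(e, u, b). e \<in> medges L \<and> u \<in> ends L e \<and> (b \<longrightarrow> ends L e = {u})}"

definition arc_inv :: "('v, 'e) multigraph \<Rightarrow> ('v, 'e) arc \<Rightarrow> ('v, 'e) arc" where
  "arc_inv L = (\<lambda>(e, u, b).
     if ends L e = {u} then (e, u, \<not> b) else (e, THE v. v \<in> ends L e \<and> v \<noteq> u, b))"

definition out :: "('v, 'e) multigraph \<Rightarrow> 'v \<Rightarrow> ('v, 'e) arc set" where
  "out L u = {a \<in> arcs L. arc_tail a = u}"

text \<open>A loop contributes 2 to the valence of its vertex.\<close>

definition mregular :: "nat \<Rightarrow> ('v, 'e) multigraph \<Rightarrow> bool" where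
  "mregular k L \<longleftrightarrow> (\<forall>u\<in>mverts L. finite (out L u) \<and> card (out L u) = k)"

text \<open>The action on arcs is part of an automorphism because the actions on vertices and edges do
  not determine it at loops. In a loopless graph it is determined by them.\<close>

definition multigraph_aut ::
  "('v, 'e) multigraph \<Rightarrow> ('v \<Rightarrow> 'v) \<Rightarrow> ('e \<Rightarrow> 'e) \<Rightarrow> (('v, 'e) arc \<Rightarrow> ('v, 'e) arc) \<Rightarrow> bool" where
  "multigraph_aut L \<phi> \<psi> \<alpha> \<longleftrightarrow>
     bij_betw \<phi> (mverts L) (mverts L) \<and>
     bij_betw \<psi> (medges L) (medges L) \<and>
     bij_betw \<alpha> (arcs L) (arcs L) \<and>
     (\<forall>e\<in>medges L. ends L (\<psi> e) = \<phi> ` ends L e) \<and>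
     (\<forall>a\<in>arcs L. arc_edge (\<alpha> a) = \<psi> (arc_edge a) \<and> arc_tail (\<alpha> a) = \<phi> (arc_tail a) \<and>
        \<alpha> (arc_inv L a) = arc_inv L (\<alpha> a))"

subsection \<open>Dihedral schemes and truncations\<close>

definition relation_graph :: "'a set \<Rightarrow> ('a \<times> 'a) set \<Rightarrow> 'a sgraph" where
  "relation_graph A R = \<lparr>verts = A, edges = {{s, t} | s t. (s, t) \<in> R}\<rparr>"

definition dihedral_scheme ::
  "('v, 'e) multigraph \<Rightarrow> (('v, 'e) arc \<times> ('v, 'e) arc) set \<Rightarrow> bool" where
  "dihedral_scheme L R \<longleftrightarrow>
     R \<subseteq> arcs L \<times> arcs L \<and> irrefl R \<and> sym R \<and>
     regular 2 (relation_graph (arcs L) R) \<and>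
     components (relation_graph (arcs L) R) = out L ` mverts L"

definition truncation ::
  "('v, 'e) multigraph \<Rightarrow> (('v, 'e) arc \<times> ('v, 'e) arc) set \<Rightarrow> ('v, 'e) arc sgraph" where
  "truncation L R =
     \<lparr>verts = arcs L,
      edges = {{s, t} | s t. s \<in> arcs L \<and> t \<in> arcs L \<and> ((s, t) \<in> R \<or> t = arc_inv L s)}\<rparr>"

definition arc_transitive_scheme ::
  "('v, 'e) multigraph \<Rightarrow> (('v, 'e) arc \<times> ('v, 'e) arc) set \<Rightarrow> bool" where
  "arc_transitive_scheme L R \<longleftrightarrow>
     (\<forall>s\<in>arcs L. \<forall>t\<in>arcs L. \<exists>\<phi> \<psi> \<alpha>. multigraph_aut L \<phi> \<psi> \<alpha> \<and>
        (\<forall>a\<in>arcs L. \<forall>b\<in>arcs L. (a, b) \<in> R \<longleftrightarrow> (\<alpha> a, \<alpha> b) \<in> R) \<and> \<alpha> s = t)"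

end

(*
  Every girth cycle through a vertex uses two of its three edges, so signature (0,1,1) forces exactly
  one girth cycle through each vertex, consisting of edges with eps = 1, while the third edge (the
  spoke) lies on no girth cycle. Contracting the girth cycles gives Lambda: its vertices are the
  girth cycles (encoded by their vertex sets) and its edges are the spokes. A vertex v of Gamma
  becomes the arc of Lambda along the spoke of v with tail the girth cycle of v, and the remaining
  edges of Gamma form the dihedral scheme. There are no loops because a chord of a girth cycle would
  yield a shorter cycle. Automorphisms of Gamma permute the girth cycles, hence act on Lambda.
*)
theory Submission
  imports Defs
begin

section \<open>Cycles given by vertex lists\<close>

text \<open>Written as an image over the index set, so that counting the edges becomes a matter of
  injectivity.\<close>

definition cycle_edges :: "'a list \<Rightarrow> 'a set set" where
  "cycle_edges vs = (\<lambda>i. {vs ! i, vs ! (Suc i mod length vs)}) ` {..<length vs}"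

lemma is_cycle_iff:
  "is_cycle G C \<longleftrightarrow> C \<subseteq> edges G \<and>
     (\<exists>vs. distinct vs \<and> 3 \<le> length vs \<and> set vs \<subseteq> verts G \<and> C = cycle_edges vs)"
proof -
  have "{{vs ! i, vs ! (Suc i mod length vs)} | i. i < length vs} = cycle_edges vs" for vs :: "'a list"
    by (auto simp: cycle_edges_def)
  then show ?thesis by (simp add: is_cycle_def)
qed

lemma is_cycleE:
  assumes "is_cycle G C"
  obtains vs where "distinct vs" "3 \<le> length vs" "set vs \<subseteq> verts G" "C = cycle_edges vs"
  using assms by (auto simp: is_cycle_iff)

text \<open>If two indices give the same edge, they are equal or each is the cyclic successor of the
  other. The latter would make two steps a full turn, which a length of at least 3 forbids.\<close>

lemma inj_on_cycle_edges:
  assumes "distinct vs" "3 \<le> length vs"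
  shows "inj_on (\<lambda>i. {vs ! i, vs ! (Suc i mod length vs)}) {..<length vs}"
proof (rule inj_onI)
  fix i j assume ij: "i \<in> {..<length vs}" "j \<in> {..<length vs}"
    and eq: "{vs ! i, vs ! (Suc i mod length vs)} = {vs ! j, vs ! (Suc j mod length vs)}"
  have lt: "Suc k mod length vs < length vs" for k
    using assms(2) by (intro mod_less_divisor) auto
  have "i = j \<or> i = Suc j mod length vs \<and> j = Suc i mod length vs"
    using eq ij lt assms(1) by (auto simp: doubleton_eq_iff nth_eq_iff_index_eq)
  then show "i = j"
    using ij assms(2) by (auto simp: mod_Suc split: if_splits)
qed

lemma card_cycle_edges:
  assumes "distinct vs" "3 \<le> length vs"
  shows "card (cycle_edges vs) = length vs"
  using card_image[OF inj_on_cycle_edges[OF assms]] by (simp add: cycle_edges_def)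

lemma Union_cycle_edges: "\<Union> (cycle_edges vs) = set vs"
proof
  show "\<Union> (cycle_edges vs) \<subseteq> set vs"
  proof
    fix x assume "x \<in> \<Union> (cycle_edges vs)"
    then obtain i where i: "i < length vs" "x = vs ! i \<or> x = vs ! (Suc i mod length vs)"
      by (auto simp: cycle_edges_def)
    moreover have "Suc i mod length vs < length vs"
      using i(1) by (intro mod_less_divisor) auto
    ultimately show "x \<in> set vs" by auto
  qed
  show "set vs \<subseteq> \<Union> (cycle_edges vs)"
    by (auto simp: cycle_edges_def in_set_conv_nth)
qed

lemma is_cycle_two_edges_at:
  assumes "is_cycle G C" "v \<in> \<Union> C"
  obtains e e' where "e \<in> C" "e' \<in> C" "e \<noteq> e'" "v \<in> e" "v \<in> e'"
proof -
  obtain vs where vs: "distinct vs" "3 \<le> length vs" "C = cycle_edges vs"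
    using assms(1) by (rule is_cycleE)
  define E where "E = (\<lambda>i. {vs ! i, vs ! (Suc i mod length vs)})"
  obtain i where i: "i < length vs" "v = vs ! i"
    using assms(2) vs by (auto simp: Union_cycle_edges in_set_conv_nth)
  \<comment> \<open>\<open>p\<close> is the cyclic predecessor of \<open>i\<close>, so the edges
    with indices \<open>p\<close> and \<open>i\<close> are the two that meet in
    \<open>v\<close>.\<close>
  define p where "p = (if i = 0 then length vs - 1 else i - 1)"
  have p: "p < length vs" "Suc p mod length vs = i" "p \<noteq> i"
    using i vs(2) by (auto simp: p_def)
  have "E i \<noteq> E p"
    using inj_on_cycle_edges[OF vs(1,2)] i p by (auto simp: E_def inj_on_def)
  moreover have "E i \<in> C" "E p \<in> C"
    using i p by (auto simp: E_def vs(3) cycle_edges_def)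
  moreover have "v \<in> E i" "v \<in> E p"
    using i p by (auto simp: E_def)
  ultimately show ?thesis using that by blast
qed

text \<open>Walking along the list reaches every vertex from \<open>vs ! 0\<close>, and the step
  relation is symmetric, so any two vertices are joined through \<open>vs ! 0\<close>.\<close>

lemma is_cycle_connected:
  assumes "is_cycle G C" "u \<in> \<Union> C" "w \<in> \<Union> C"
  shows "(u, w) \<in> {(x, y). {x, y} \<in> C}\<^sup>*"
proof -
  obtain vs where vs: "distinct vs" "3 \<le> length vs" "C = cycle_edges vs"
    using assms(1) by (rule is_cycleE)
  let ?r = "{(x, y). {x, y} \<in> C}"
  have start: "(vs ! 0, vs ! i) \<in> ?r\<^sup>*" if "i < length vs" for i
    using that
  proof (induction i)
    case (Suc i)
    have "{vs ! i, vs ! Suc i} \<in> C"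
      using Suc.prems unfolding vs(3) cycle_edges_def by (intro image_eqI[of _ _ i]) auto
    with Suc show ?case by (auto intro: rtrancl_into_rtrancl)
  qed simp
  have "sym (?r\<^sup>*)" by (intro sym_rtrancl) (auto simp: sym_def insert_commute)
  moreover have "(vs ! 0, u) \<in> ?r\<^sup>*" "(vs ! 0, w) \<in> ?r\<^sup>*"
    using assms(2,3) start by (auto simp: vs(3) Union_cycle_edges in_set_conv_nth)
  ultimately show ?thesis by (meson symD rtrancl_trans)
qed

text \<open>The chord closes up the segment of the vertex list between its two ends. Since the chord
  is not an edge of \<open>C\<close>, its ends are not cyclically adjacent, so this segment has at
  least three vertices and misses at least one.\<close>

lemma chord_gives_shorter_cycle:
  assumes "is_cycle G C" "{u, w} \<in> edges G" "{u, w} \<notin> C" "u \<in> \<Union> C" "w \<in> \<Union> C" "u \<noteq> w"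
  obtains D where "is_cycle G D" "card D < card C"
proof -
  obtain vs where vs: "distinct vs" "3 \<le> length vs" "set vs \<subseteq> verts G" "C = cycle_edges vs"
    using assms(1) by (rule is_cycleE)
  obtain i j where ij: "i < j" "j < length vs" and uw: "{u, w} = {vs ! i, vs ! j}"
  proof -
    obtain a b where ab: "a < length vs" "b < length vs" "u = vs ! a" "w = vs ! b"
      using assms(4,5) by (auto simp: vs(4) Union_cycle_edges in_set_conv_nth)
    then have "a < b \<or> b < a" using assms(6) by (metis linorder_neqE_nat)
    then show ?thesis using that ab by (metis insert_commute)
  qed
  have edge: "{vs ! k, vs ! (Suc k mod length vs)} \<in> C" if "k < length vs" for k
    using that by (auto simp: vs(4) cycle_edges_def)
  have "j \<noteq> Suc i" using edge[of i] ij uw assms(3) by auto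
  \<comment> \<open>The first and the last entry of the list are adjacent as well, through the
    wrap-around edge.\<close>
  moreover have "\<not> (i = 0 \<and> Suc j = length vs)"
    using edge[of j] ij uw assms(3) by (auto simp: insert_commute)
  ultimately have gap: "3 \<le> Suc (j - i)" "Suc (j - i) < length vs" using ij by auto
  define ws where "ws = take (Suc (j - i)) (drop i vs)"
  have len: "length ws = Suc (j - i)" using ij by (simp add: ws_def)
  have nth: "ws ! k = vs ! (i + k)" if "k \<le> j - i" for k
    using that ij by (simp add: ws_def)
  have ws: "distinct ws" "set ws \<subseteq> verts G"
    using vs(1,3) set_take_subset[of "Suc (j - i)" "drop i vs"] set_drop_subset[of i vs]
    by (auto simp: ws_def)
  have "{ws ! k, ws ! (Suc k mod length ws)} \<in> edges G" if "k < length ws" for k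
  \<comment> \<open>The closing pair of \<open>ws\<close> is the chord; every other pair is already
    consecutive in \<open>vs\<close>.\<close>
  proof (cases "k = j - i")
    case True
    then have "{ws ! k, ws ! (Suc k mod length ws)} = {u, w}"
      using ij uw by (simp add: len nth insert_commute)
    then show ?thesis using assms(2) by simp
  next
    case False
    then have "{ws ! k, ws ! (Suc k mod length ws)} = {vs ! (i + k), vs ! (Suc (i + k) mod length vs)}"
      using that ij len nth by simp
    then show ?thesis
      using edge[of "i + k"] False that ij len assms(1) by (auto simp: is_cycle_iff)
  qed
  then have "is_cycle G (cycle_edges ws)"
    using ws gap len unfolding is_cycle_iff by (auto simp: cycle_edges_def)
  moreover have "card (cycle_edges ws) < card C"
    using ws vs gap len by (simp add: card_cycle_edges)
  ultimately show ?thesis by (rule that)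
qed

lemma cycle_edges_map:
  "cycle_edges (map h vs) = (`) h ` cycle_edges vs"
proof -
  have "Suc i mod length vs < length vs" if "i < length vs" for i
    using that by (intro mod_less_divisor) auto
  then show ?thesis
    unfolding cycle_edges_def image_image by (intro image_cong) auto
qed

section \<open>Automorphisms preserve girth cycles\<close>

lemma graph_iso_image_edge:
  assumes "simple_graph G" "graph_iso G H h" "e \<in> edges G"
  shows "h ` e \<in> edges H"
proof -
  obtain x y where "e = {x, y}" "x \<in> verts G" "y \<in> verts G"
    using assms(1,3) by (fastforce simp: simple_graph_def card_2_iff)
  then show ?thesis using assms(2,3) by (auto simp: graph_iso_def)
qed

lemma graph_iso_inj_image:
  assumes "simple_graph G" "graph_iso G H h"
  shows "inj_on ((`) h) (edges G)"
proof (rule inj_on_subset)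
  show "inj_on ((`) h) (Pow (verts G))"
    using assms(2) by (simp add: graph_iso_def bij_betw_def inj_on_image_Pow)
  show "edges G \<subseteq> Pow (verts G)" using assms(1) by (auto simp: simple_graph_def)
qed

text \<open>With the inverse at hand, a property carried forward by every automorphism is also
  reflected by it.\<close>

lemma graph_iso_inv:
  assumes "graph_iso G G h"
  shows "graph_iso G G (inv_into (verts G) h)"
proof -
  let ?k = "inv_into (verts G) h"
  have h: "bij_betw h (verts G) (verts G)" using assms by (simp add: graph_iso_def)
  then have k: "bij_betw ?k (verts G) (verts G)" by (rule bij_betw_inv_into)
  have "{u, v} \<in> edges G \<longleftrightarrow> {?k u, ?k v} \<in> edges G" if "u \<in> verts G" "v \<in> verts G" for u v
  proof -
    have "?k u \<in> verts G" "?k v \<in> verts G" using k that by (auto simp: bij_betw_def)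
    moreover have "h (?k u) = u" "h (?k v) = v"
      using h that by (auto simp: bij_betw_inv_into_right)
    ultimately show ?thesis using assms unfolding graph_iso_def by metis
  qed
  with k show ?thesis by (simp add: graph_iso_def)
qed

lemma is_cycle_image:
  assumes "simple_graph G" "graph_iso G G h" "is_cycle G C"
  shows "is_cycle G ((`) h ` C)"
proof -
  obtain vs where vs: "distinct vs" "3 \<le> length vs" "set vs \<subseteq> verts G" "C = cycle_edges vs"
    using assms(3) by (rule is_cycleE)
  have bij: "bij_betw h (verts G) (verts G)" using assms(2) by (simp add: graph_iso_def)
  have "distinct (map h vs)"
    using vs bij by (auto simp: distinct_map bij_betw_def intro: inj_on_subset)
  moreover have "set (map h vs) \<subseteq> verts G" using vs bij by (auto simp: bij_betw_def)
  moreover have "(`) h ` C \<subseteq> edges G"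
    using assms graph_iso_image_edge by (fastforce simp: is_cycle_iff)
  ultimately show ?thesis
    unfolding is_cycle_iff using vs by (metis cycle_edges_map length_map)
qed

text \<open>An automorphism is injective on edges, so the image cycle has the same length.\<close>

lemma girth_cycle_image:
  assumes "simple_graph G" "graph_iso G G h" "girth_cycle G C"
  shows "girth_cycle G ((`) h ` C)"
proof -
  have C: "is_cycle G C" using assms(3) by (simp add: girth_cycle_def)
  then have "C \<subseteq> edges G" by (simp add: is_cycle_iff)
  then have "card ((`) h ` C) = card C"
    using graph_iso_inj_image[OF assms(1,2)] by (intro card_image) (rule inj_on_subset)
  then show ?thesis
    using assms(3) is_cycle_image[OF assms(1,2) C] by (simp add: girth_cycle_def)
qed

section \<open>Adjacency in relation graphs and truncations\<close>

lemma relation_graph_edge_iff: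
  assumes "sym R"
  shows "{s, t} \<in> edges (relation_graph A R) \<longleftrightarrow> (s, t) \<in> R"
  using assms by (auto simp: relation_graph_def doubleton_eq_iff dest: symD)

text \<open>Edges are unordered pairs, so each of the two adjacency conditions occurs in both
  orders.\<close>

lemma truncation_edge_iff:
  "{s, t} \<in> edges (truncation L R) \<longleftrightarrow> s \<in> arcs L \<and> t \<in> arcs L \<and>
     ((s, t) \<in> R \<or> t = arc_inv L s \<or> (t, s) \<in> R \<or> s = arc_inv L t)"
  unfolding truncation_def sgraph.simps mem_Collect_eq doubleton_eq_iff by blast

section \<open>The multigraph of girth cycles\<close>

locale signature_011 =
  fixes G :: "'a sgraph" and g :: nat
  assumes simple: "simple_graph G"
    and cubic: "cubic G"
    and girth: "girth G = enat g"
    and signature: "has_signature G [0, 1, 1]"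
begin

lemma edgeD: "e \<in> edges G \<Longrightarrow> e \<subseteq> verts G \<and> card e = 2"
  using simple by (simp add: simple_graph_def)

lemma edge_verts: "{u, v} \<in> edges G \<Longrightarrow> u \<in> verts G \<and> v \<in> verts G \<and> u \<noteq> v"
  using edgeD[of "{u, v}"] by (auto simp: card_insert_if split: if_splits)

lemma edge_other:
  assumes "e \<in> edges G" "u \<in> e"
  obtains v where "e = {u, v}" "u \<noteq> v"
  using edgeD[OF assms(1)] assms(2) by (auto simp: card_2_iff)

lemma girth_cycleD: "girth_cycle G C \<Longrightarrow> is_cycle G C \<and> C \<subseteq> edges G \<and> card C = g \<and> \<Union> C \<subseteq> verts G"
  using edgeD by (auto simp: girth_cycle_def girth is_cycle_iff)

lemma girth_le: "is_cycle G C \<Longrightarrow> g \<le> card C"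
proof -
  assume "is_cycle G C"
  then have "girth G \<le> enat (card C)" unfolding girth_def by (intro INF_lower) simp
  then show ?thesis by (simp add: girth)
qed

lemma incident_edges_eq:
  assumes "v \<in> verts G"
  obtains a b c where "incident_edges G v = {a, b, c}" "distinct [a, b, c]"
    "eps G a = 0" "eps G b = 1" "eps G c = 1"
proof -
  have "card (incident_edges G v) = 3" using cubic assms by (auto simp: regular_def)
  then obtain x y z where xyz: "incident_edges G v = {x, y, z}" "x \<noteq> y" "y \<noteq> z" "x \<noteq> z"
    by (auto simp: card_3_iff)
  have "sorted_list_of_multiset (image_mset (eps G) (mset_set (incident_edges G v))) = [0, 1, 1]"
    using signature assms by (auto simp: has_signature_def vertex_signature_def)
  \<comment> \<open>Applying \<open>mset\<close> undoes the sorting; what remains is to locate the 0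
    among the three edges and name that edge \<open>a\<close>.\<close>
  then have "image_mset (eps G) (mset_set (incident_edges G v)) = {#0, 1, 1#}"
    by (metis mset_sorted_list_of_multiset mset.simps)
  then have "{#eps G x, eps G y, eps G z#} = {#0, 1, 1#}"
    using xyz by simp
  then have "(eps G x, eps G y, eps G z) \<in> {(0, 1, 1), (1, 0, 1), (1, 1, 0)}"
    by (auto simp: add_eq_conv_ex)
  then consider "eps G x = 0" "eps G y = 1" "eps G z = 1"
    | "eps G x = 1" "eps G y = 0" "eps G z = 1"
    | "eps G x = 1" "eps G y = 1" "eps G z = 0"
    by auto
  then show ?thesis
  proof cases
    case 1
    then show ?thesis using that[of x y z] xyz by auto
  next
    case 2
    then show ?thesis using that[of y x z] xyz by (auto simp: insert_commute)
  next
    case 3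
    then show ?thesis using that[of z x y] xyz by (auto simp: insert_commute)
  qed
qed

section \<open>The unique girth cycle through each vertex\<close>

lemma girth_cycle_two_edges_at:
  assumes "girth_cycle G C" "v \<in> \<Union> C"
  obtains e e' where "e \<in> C" "e' \<in> C" "e \<noteq> e'" "e \<in> incident_edges G v" "e' \<in> incident_edges G v"
proof -
  obtain e e' where "e \<in> C" "e' \<in> C" "e \<noteq> e'" "v \<in> e" "v \<in> e'"
    using is_cycle_two_edges_at girth_cycleD assms by metis
  then show ?thesis using that girth_cycleD[OF assms(1)] by (auto simp: incident_edges_def)
qed

text \<open>The definition of \<^const>\<open>eps\<close> also yields 0 on edges in infinitely many girth cycles. These
  do not exist, since each such cycle passes through one of the two other edges at an end-vertex.\<close>

lemma eps_0_iff:
  assumes "e \<in> edges G"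
  shows "eps G e = 0 \<longleftrightarrow> (\<forall>C. girth_cycle G C \<longrightarrow> e \<notin> C)"
proof
  assume e0: "eps G e = 0"
  obtain v where v: "v \<in> e" "v \<in> verts G" using edgeD[OF assms] by (fastforce simp: card_2_iff)
  obtain a b c where abc: "incident_edges G v = {a, b, c}" "distinct [a, b, c]"
    "eps G a = 0" "eps G b = 1" "eps G c = 1"
    using incident_edges_eq[OF v(2)] .
  have "e \<in> {a, b, c}" unfolding abc(1)[symmetric] using assms v by (simp add: incident_edges_def)
  then have "e = a" using abc(4,5) e0 by auto
  let ?S = "\<lambda>e. {C. girth_cycle G C \<and> e \<in> C}"
  have "?S a \<subseteq> ?S b \<union> ?S c"
  proof
    fix C assume "C \<in> ?S a"
    then have C: "girth_cycle G C" "v \<in> \<Union> C" using v \<open>e = a\<close> by auto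
    then obtain d d' where "d \<in> C" "d' \<in> C" "d \<noteq> d'" "d \<in> {a, b, c}" "d' \<in> {a, b, c}"
      using girth_cycle_two_edges_at abc(1) by metis
    then show "C \<in> ?S b \<union> ?S c" using C(1) by auto
  qed
  \<comment> \<open>An infinite set has \<open>card\<close> 0, so the value 1 certifies finiteness.
    For \<open>a\<close> finiteness must be inherited before its value 0 can mean emptiness.\<close>
  moreover have "finite (?S b)" "finite (?S c)"
    using abc(4,5) by (simp_all add: eps_def card_ge_0_finite)
  ultimately have "finite (?S a)" by (meson finite_UnI finite_subset)
  then have "?S a = {}" using abc(3) by (simp add: eps_def)
  then show "\<forall>C. girth_cycle G C \<longrightarrow> e \<notin> C" using \<open>e = a\<close> by blast
next
  assume "\<forall>C. girth_cycle G C \<longrightarrow> e \<notin> C"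
  then have "{C. girth_cycle G C \<and> e \<in> C} = {}" by blast
  then show "eps G e = 0" unfolding eps_def by (metis card.empty)
qed

text \<open>The only girth cycle through \<open>b\<close> passes through \<open>v\<close>. Any girth
  cycle through \<open>v\<close> uses two of \<open>a\<close>, \<open>b\<close>, \<open>c\<close>
  but never \<open>a\<close>, hence it contains \<open>b\<close> and is that one.\<close>

lemma ex1_girth_cycle:
  assumes "v \<in> verts G"
  shows "\<exists>!C. girth_cycle G C \<and> v \<in> \<Union> C"
proof -
  obtain a b c where abc: "incident_edges G v = {a, b, c}" "distinct [a, b, c]"
    "eps G a = 0" "eps G b = 1" "eps G c = 1"
    using incident_edges_eq[OF assms] .
  have "a \<in> edges G" "v \<in> b" using abc(1) by (auto simp: incident_edges_def)
  have "card {C. girth_cycle G C \<and> b \<in> C} = 1" using abc(4) by (simp add: eps_def)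
  then obtain C where C: "{C. girth_cycle G C \<and> b \<in> C} = {C}" by (auto simp: card_1_singleton_iff)
  show ?thesis
  proof (rule ex1I)
    show "girth_cycle G C \<and> v \<in> \<Union> C" using C \<open>v \<in> b\<close> by blast
    fix D assume D: "girth_cycle G D \<and> v \<in> \<Union> D"
    then obtain e e' where e: "e \<in> D" "e' \<in> D" "e \<noteq> e'" "e \<in> {a, b, c}" "e' \<in> {a, b, c}"
      using girth_cycle_two_edges_at abc(1) by metis
    moreover have "a \<notin> D" using eps_0_iff \<open>a \<in> edges G\<close> abc(3) D by blast
    ultimately have "b \<in> D" by auto
    then show "D = C" using C D by blast
  qed
qed

definition girth_at :: "'a \<Rightarrow> 'a set set" where
  "girth_at v = (THE C. girth_cycle G C \<and> v \<in> \<Union> C)"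

text \<open>Distinct girth cycles share no vertex, so the vertex set already identifies the
  cycle.\<close>

definition cyc :: "'a \<Rightarrow> 'a set" where
  "cyc v = \<Union> (girth_at v)"

lemma girth_at: "v \<in> verts G \<Longrightarrow> girth_cycle G (girth_at v) \<and> v \<in> \<Union> (girth_at v)"
  unfolding girth_at_def by (rule theI') (rule ex1_girth_cycle)

lemma girth_at_eq:
  assumes "girth_cycle G C" "v \<in> \<Union> C"
  shows "girth_at v = C"
proof -
  have "v \<in> verts G" using girth_cycleD assms by blast
  then show ?thesis using ex1_girth_cycle girth_at assms by blast
qed

lemma cyc_self: "v \<in> verts G \<Longrightarrow> v \<in> cyc v"
  using girth_at by (simp add: cyc_def)

lemma cyc_subset: "v \<in> verts G \<Longrightarrow> cyc v \<subseteq> verts G"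
  using girth_at girth_cycleD by (simp add: cyc_def)

lemma girth_at_cong: "v \<in> verts G \<Longrightarrow> w \<in> cyc v \<Longrightarrow> girth_at w = girth_at v"
  using girth_at girth_at_eq by (simp add: cyc_def)

lemma cyc_cong: "v \<in> verts G \<Longrightarrow> w \<in> cyc v \<Longrightarrow> cyc w = cyc v"
  by (metis cyc_def girth_at_cong)

text \<open>The girth cycles partition the vertices, with \<open>cyc v\<close> as the class of
  \<open>v\<close>.\<close>

lemma mem_cyc_iff: "v \<in> verts G \<Longrightarrow> w \<in> verts G \<Longrightarrow> w \<in> cyc v \<longleftrightarrow> cyc w = cyc v"
  using cyc_cong cyc_self by blast

text \<open>A cycle has as many vertices as edges. This is the source of the valence
  \<open>g\<close> of the contracted multigraph.\<close>

lemma card_cyc: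
  assumes "v \<in> verts G"
  shows "finite (cyc v) \<and> card (cyc v) = g"
proof -
  have C: "is_cycle G (girth_at v)" "card (girth_at v) = g"
    using girth_cycleD girth_at assms by auto
  obtain vs where "distinct vs" "3 \<le> length vs" "girth_at v = cycle_edges vs"
    using C(1) by (rule is_cycleE)
  then show ?thesis
    using C(2) by (simp add: cyc_def Union_cycle_edges card_cycle_edges distinct_card)
qed

text \<open>Some girth cycle contains the edge and so passes through both ends; by uniqueness it is
  the girth cycle of each.\<close>

lemma edge_eps_nonzero:
  assumes "{u, v} \<in> edges G" "eps G {u, v} \<noteq> 0"
  shows "{u, v} \<in> girth_at u \<and> cyc v = cyc u"
proof -
  obtain C where C: "girth_cycle G C" "{u, v} \<in> C" using eps_0_iff[OF assms(1)] assms(2) by auto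
  then have "girth_at u = C" "girth_at v = C" using girth_at_eq[OF C(1)] by blast+
  then show ?thesis using C by (simp add: cyc_def)
qed

text \<open>A girth cycle has no chords, which is why the multigraph of girth cycles has no loops.\<close>

lemma edge_eps_zero:
  assumes "{u, v} \<in> edges G" "eps G {u, v} = 0"
  shows "cyc v \<noteq> cyc u"
proof
  assume eq: "cyc v = cyc u"
  have uv: "u \<in> verts G" "v \<in> verts G" "u \<noteq> v" using edge_verts assms by auto
  let ?C = "girth_at u"
  have C: "girth_cycle G ?C" using girth_at uv by blast
  have "{u, v} \<notin> ?C" using eps_0_iff[OF assms(1)] assms(2) C by auto
  moreover have "u \<in> \<Union> ?C" "v \<in> \<Union> ?C" using uv cyc_self eq by (auto simp: cyc_def)
  ultimately obtain D where "is_cycle G D" "card D < card ?C"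
    using chord_gives_shorter_cycle girth_cycleD[OF C] assms(1) uv(3) by metis
  then show False using girth_le[of D] girth_cycleD[OF C] by simp
qed

section \<open>Spokes and the contracted multigraph\<close>

definition spoke :: "'a \<Rightarrow> 'a set" where
  "spoke v = (THE e. e \<in> incident_edges G v \<and> eps G e = 0)"

lemma ex1_spoke:
  assumes "v \<in> verts G"
  shows "\<exists>!e. e \<in> incident_edges G v \<and> eps G e = 0"
proof -
  obtain a b c where "incident_edges G v = {a, b, c}" "distinct [a, b, c]"
    "eps G a = 0" "eps G b = 1" "eps G c = 1"
    using incident_edges_eq[OF assms] .
  then show ?thesis by (intro ex1I[of _ a]) fastforce+
qed

lemma spoke:
  assumes "v \<in> verts G"
  shows "spoke v \<in> edges G" "v \<in> spoke v" "eps G (spoke v) = 0"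
  using theI'[OF ex1_spoke[OF assms]] unfolding spoke_def[symmetric] by (auto simp: incident_edges_def)

lemma spoke_eq:
  assumes "e \<in> edges G" "v \<in> e" "eps G e = 0"
  shows "spoke v = e"
proof -
  have "v \<in> verts G" using edgeD assms by blast
  then show ?thesis
    using ex1_spoke[of v] spoke[of v] assms by (auto simp: incident_edges_def)
qed

text \<open>The tag is constantly \<open>False\<close>, the tag of arcs on non-loops; the contracted
  multigraph turns out to have no loops.\<close>

definition to_arc :: "'a \<Rightarrow> ('a set, 'a set) arc" where
  "to_arc v = (spoke v, cyc v, False)"

text \<open>The spokes themselves serve as edges, so several spokes between the same two girth
  cycles remain distinct parallel edges.\<close>

definition cycle_graph :: "('a set, 'a set) multigraph" where
  "cycle_graph = \<lparr>mverts = cyc ` verts G, medges = {e \<in> edges G. eps G e = 0}, ends = (\<lambda>e. cyc ` e)\<rparr>"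

definition cycle_scheme :: "(('a set, 'a set) arc \<times> ('a set, 'a set) arc) set" where
  "cycle_scheme = {(to_arc u, to_arc v) | u v. {u, v} \<in> edges G \<and> eps G {u, v} \<noteq> 0}"

text \<open>Two distinct vertices with the same arc would be the two ends of one spoke, yet lie on a
  common girth cycle. This contradicts \<open>edge_eps_zero\<close>.\<close>

lemma inj_to_arc: "inj_on to_arc (verts G)"
proof (rule inj_onI, rule ccontr)
  fix u v assume uv: "u \<in> verts G" "v \<in> verts G" "to_arc u = to_arc v" "u \<noteq> v"
  then have "u \<in> spoke u" "v \<in> spoke u" "spoke u \<in> edges G" "eps G (spoke u) = 0" "cyc v = cyc u"
    using spoke[of u] spoke[of v] by (auto simp: to_arc_def)
  moreover from this have "spoke u = {u, v}" using uv(4) by (metis edge_other insertE singletonD)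
  ultimately show False using edge_eps_zero by metis
qed

lemma to_arc_eq_iff: "u \<in> verts G \<Longrightarrow> v \<in> verts G \<Longrightarrow> to_arc u = to_arc v \<longleftrightarrow> u = v"
  using inj_to_arc by (auto simp: inj_on_def)

lemma card_ends:
  assumes "e \<in> medges cycle_graph"
  shows "card (ends cycle_graph e) = 2"
proof -
  have e: "e \<in> edges G" "eps G e = 0" using assms by (auto simp: cycle_graph_def)
  then obtain u v where "e = {u, v}" using edgeD by (meson card_2_iff)
  moreover from this have "cyc v \<noteq> cyc u" using edge_eps_zero e by simp
  ultimately show ?thesis by (simp add: cycle_graph_def)
qed

lemma multigraph_cycle_graph: "multigraph cycle_graph"
proof -
  have "ends cycle_graph e \<subseteq> mverts cycle_graph" if "e \<in> medges cycle_graph" for e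
    using that edgeD by (auto simp: cycle_graph_def)
  then show ?thesis using card_ends by (simp add: multigraph_def)
qed

lemma loopless_cycle_graph: "loopless cycle_graph"
  using card_ends by (simp add: loopless_def)

lemma arcs_cycle_graph: "arcs cycle_graph = to_arc ` verts G"
proof (intro equalityI subsetI)
  fix x assume "x \<in> arcs cycle_graph"
  then obtain e v b where x: "x = (e, cyc v, b)" "e \<in> medges cycle_graph" "v \<in> e"
      "b \<longrightarrow> ends cycle_graph e = {cyc v}"
    by (auto simp: arcs_def cycle_graph_def)
  \<comment> \<open>The tag \<open>True\<close> occurs only at loops, whereas every edge here has
    two ends.\<close>
  then have "\<not> b" using card_ends[of e] by auto
  moreover have e: "e \<in> edges G" "eps G e = 0" using x(2) by (auto simp: cycle_graph_def)
  moreover have "spoke v = e" "v \<in> verts G"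
    using x(3) e spoke_eq edgeD by blast+
  ultimately show "x \<in> to_arc ` verts G" using x by (auto simp: to_arc_def)
next
  fix x assume "x \<in> to_arc ` verts G"
  then show "x \<in> arcs cycle_graph"
    using spoke by (auto simp: to_arc_def arcs_def cycle_graph_def)
qed

lemma arc_inv_to_arc:
  assumes "{u, v} \<in> edges G" "eps G {u, v} = 0"
  shows "arc_inv cycle_graph (to_arc u) = to_arc v"
proof -
  have sp: "spoke u = {u, v}" "spoke v = {u, v}" using spoke_eq assms by auto
  have ne: "cyc v \<noteq> cyc u" using edge_eps_zero assms by blast
  then have "(THE X. X \<in> cyc ` {u, v} \<and> X \<noteq> cyc u) = cyc v" by (intro the_equality) auto
  moreover have "cyc ` {u, v} \<noteq> {cyc u}" using ne by auto
  ultimately show ?thesis by (simp add: arc_inv_def to_arc_def cycle_graph_def sp)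
qed

lemma out_cycle_graph:
  assumes "v \<in> verts G"
  shows "out cycle_graph (cyc v) = to_arc ` cyc v"
proof -
  have "out cycle_graph (cyc v) = to_arc ` {w \<in> verts G. arc_tail (to_arc w) = cyc v}"
    by (auto simp only: out_def arcs_cycle_graph)
  also have "{w \<in> verts G. arc_tail (to_arc w) = cyc v} = cyc v"
    using assms cyc_subset[OF assms] mem_cyc_iff[OF assms] by (auto simp: arc_tail_def to_arc_def)
  finally show ?thesis .
qed

lemma mregular_cycle_graph: "mregular g cycle_graph"
  unfolding mregular_def
proof
  fix X assume "X \<in> mverts cycle_graph"
  then obtain v where v: "v \<in> verts G" "X = cyc v" by (auto simp: cycle_graph_def)
  have "inj_on to_arc (cyc v)" using inj_to_arc cyc_subset v by (meson inj_on_subset)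
  then show "finite (out cycle_graph X) \<and> card (out cycle_graph X) = g"
    using v card_cyc by (simp add: out_cycle_graph card_image)
qed

section \<open>The dihedral scheme of the girth cycles\<close>

lemma sym_cycle_scheme: "sym cycle_scheme"
proof (rule symI)
  fix s t assume "(s, t) \<in> cycle_scheme"
  then obtain u v where "s = to_arc u" "t = to_arc v" "{v, u} \<in> edges G" "eps G {v, u} \<noteq> 0"
    unfolding cycle_scheme_def by (auto simp: insert_commute)
  then show "(t, s) \<in> cycle_scheme" unfolding cycle_scheme_def by blast
qed

lemma cycle_scheme_iff:
  assumes "u \<in> verts G" "v \<in> verts G"
  shows "(to_arc u, to_arc v) \<in> cycle_scheme \<longleftrightarrow> {u, v} \<in> edges G \<and> eps G {u, v} \<noteq> 0"
  using assms edge_verts to_arc_eq_iff unfolding cycle_scheme_def by blast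

lemma edges_cycle_scheme:
  "edges (relation_graph A cycle_scheme) = (`) to_arc ` {e \<in> edges G. eps G e \<noteq> 0}"
proof (intro equalityI subsetI)
  fix x assume "x \<in> (`) to_arc ` {e \<in> edges G. eps G e \<noteq> 0}"
  then obtain e where e: "e \<in> edges G" "eps G e \<noteq> 0" "x = to_arc ` e" by auto
  then obtain u v where "e = {u, v}" using edgeD by (meson card_2_iff)
  with e have "x = {to_arc u, to_arc v}" "(to_arc u, to_arc v) \<in> cycle_scheme"
    by (auto simp: cycle_scheme_def)
  then show "x \<in> edges (relation_graph A cycle_scheme)"
    unfolding relation_graph_def sgraph.simps by blast
next
  fix x assume "x \<in> edges (relation_graph A cycle_scheme)"
  then obtain u v where "x = to_arc ` {u, v}" "{u, v} \<in> edges G" "eps G {u, v} \<noteq> 0"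
    unfolding relation_graph_def cycle_scheme_def by auto
  then show "x \<in> (`) to_arc ` {e \<in> edges G. eps G e \<noteq> 0}" by blast
qed

text \<open>Of the three edges at a vertex exactly two have nonzero \<open>eps\<close>, and
  injectivity of \<open>to_arc\<close> keeps their images distinct.\<close>

lemma regular_cycle_scheme: "regular 2 (relation_graph (arcs cycle_graph) cycle_scheme)"
proof -
  let ?H = "relation_graph (arcs cycle_graph) cycle_scheme"
  have "finite (incident_edges ?H (to_arc v)) \<and> card (incident_edges ?H (to_arc v)) = 2"
    if v: "v \<in> verts G" for v
  proof -
    obtain a b c where abc: "incident_edges G v = {a, b, c}" "distinct [a, b, c]"
      "eps G a = 0" "eps G b = 1" "eps G c = 1"
      using incident_edges_eq[OF v] .
    have "to_arc v \<in> to_arc ` e \<longleftrightarrow> v \<in> e" if "e \<in> edges G" for e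
      using edgeD[OF that] v by (auto simp: to_arc_eq_iff subset_iff)
    then have "incident_edges ?H (to_arc v) = (`) to_arc ` {e \<in> incident_edges G v. eps G e \<noteq> 0}"
      by (auto simp: incident_edges_def edges_cycle_scheme)
    also have "{e \<in> incident_edges G v. eps G e \<noteq> 0} = {b, c}"
      unfolding abc(1) using abc(3-5) by auto
    finally have eq: "incident_edges ?H (to_arc v) = {to_arc ` b, to_arc ` c}" by simp
    have "b \<subseteq> verts G" "c \<subseteq> verts G" using abc(1) edgeD by (auto simp: incident_edges_def)
    then have "to_arc ` b \<noteq> to_arc ` c"
      using abc(2) inj_on_image_eq_iff[OF inj_to_arc] by auto
    then show ?thesis by (simp add: eq)
  qed
  then show ?thesis by (auto simp: regular_def arcs_cycle_graph relation_graph_def)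
qed

text \<open>A scheme step follows an edge of nonzero \<open>eps\<close> and so never leaves the
  girth cycle. Conversely the girth cycle is connected, and all its edges have nonzero
  \<open>eps\<close>.\<close>

lemma component_cycle_scheme:
  assumes "v \<in> verts G"
  shows "component (relation_graph (arcs cycle_graph) cycle_scheme) (to_arc v) = to_arc ` cyc v"
proof -
  let ?H = "relation_graph (arcs cycle_graph) cycle_scheme"
  let ?r = "{(x, y). {x, y} \<in> edges ?H}"
  have sub: "x \<in> to_arc ` cyc v" if "(to_arc v, x) \<in> ?r\<^sup>*" for x
    using that
  proof induction
    case base
    then show ?case using assms cyc_self by blast
  next
    case (step y z)
    then obtain w where w: "w \<in> cyc v" "y = to_arc w" by auto
    then have wv: "w \<in> verts G" using cyc_subset assms by blast
    have "(to_arc w, z) \<in> cycle_scheme"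
      using step.hyps(2) w(2) by (simp add: relation_graph_edge_iff[OF sym_cycle_scheme])
    then obtain p q where pq: "{p, q} \<in> edges G" "eps G {p, q} \<noteq> 0"
        "to_arc w = to_arc p" "z = to_arc q"
      unfolding cycle_scheme_def by blast
    \<comment> \<open>The scheme yields only some preimages \<open>p\<close> and \<open>q\<close>;
      injectivity of \<open>to_arc\<close> identifies \<open>p\<close> with
      \<open>w\<close>.\<close>
    then have "p = w" "q \<in> verts G" using edge_verts[OF pq(1)] wv to_arc_eq_iff by auto
    moreover have "cyc q = cyc p" using edge_eps_nonzero pq by blast
    ultimately have "q \<in> cyc v" using \<open>p = w\<close> cyc_cong[OF assms w(1)] mem_cyc_iff[OF assms] by simp
    then show ?case using pq by blast
  qed
  have sup: "(to_arc v, to_arc w) \<in> ?r\<^sup>*" if "w \<in> cyc v" for w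
  proof -
    have C: "girth_cycle G (girth_at v)" using girth_at assms by blast
    have "(v, w) \<in> {(x, y). {x, y} \<in> girth_at v}\<^sup>*"
      using girth_cycleD[OF C] cyc_self[OF assms] that
      by (intro is_cycle_connected) (auto simp: cyc_def)
    then show ?thesis
    proof induction
      case (step y z)
      then have yz: "{y, z} \<in> edges G" using girth_cycleD[OF C] by blast
      moreover have "eps G {y, z} \<noteq> 0" using eps_0_iff[OF yz] C step.hyps(2) by auto
      ultimately have "(to_arc y, to_arc z) \<in> ?r"
        using edge_verts[OF yz]
        by (simp add: relation_graph_edge_iff[OF sym_cycle_scheme] cycle_scheme_iff)
      with step.IH show ?case by (rule rtrancl_into_rtrancl)
    qed simp
  qed
  have "verts ?H = to_arc ` verts G" by (simp add: relation_graph_def arcs_cycle_graph)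
  then show ?thesis
    using sub sup cyc_subset[OF assms] unfolding component_def by blast
qed

lemma dihedral_cycle_scheme: "dihedral_scheme cycle_graph cycle_scheme"
proof -
  have "components (relation_graph (arcs cycle_graph) cycle_scheme) = out cycle_graph ` mverts cycle_graph"
  proof -
    have "verts (relation_graph (arcs cycle_graph) cycle_scheme) = to_arc ` verts G"
      by (simp add: relation_graph_def arcs_cycle_graph)
    then have "components (relation_graph (arcs cycle_graph) cycle_scheme) = (\<lambda>v. to_arc ` cyc v) ` verts G"
      by (simp add: components_def image_image component_cycle_scheme cong: image_cong_simp)
    also have "\<dots> = out cycle_graph ` cyc ` verts G"
      by (simp add: image_image out_cycle_graph cong: image_cong_simp)
    also have "cyc ` verts G = mverts cycle_graph" by (simp add: cycle_graph_def)
    finally show ?thesis .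
  qed
  moreover have "cycle_scheme \<subseteq> arcs cycle_graph \<times> arcs cycle_graph"
    using edge_verts by (auto simp: cycle_scheme_def arcs_cycle_graph)
  moreover have "irrefl cycle_scheme"
    using edge_verts to_arc_eq_iff by (auto simp: irrefl_def cycle_scheme_def)
  ultimately show ?thesis using regular_cycle_scheme sym_cycle_scheme by (simp add: dihedral_scheme_def)
qed

section \<open>The graph as a truncation\<close>

lemma arc_inv_iff:
  assumes "u \<in> verts G" "v \<in> verts G"
  shows "to_arc v = arc_inv cycle_graph (to_arc u) \<longleftrightarrow> {u, v} \<in> edges G \<and> eps G {u, v} = 0"
proof -
  obtain w where w: "spoke u = {u, w}" using spoke[OF assms(1)] by (metis edge_other)
  then have uw: "{u, w} \<in> edges G" "eps G {u, w} = 0" using spoke[OF assms(1)] by auto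
  then have "to_arc v = arc_inv cycle_graph (to_arc u) \<longleftrightarrow> v = w"
    using arc_inv_to_arc assms edge_verts[OF uw(1)] to_arc_eq_iff by auto
  also have "\<dots> \<longleftrightarrow> {u, v} \<in> edges G \<and> eps G {u, v} = 0"
    using uw w spoke_eq[of "{u, v}" u] by (auto simp: doubleton_eq_iff)
  finally show ?thesis .
qed

text \<open>The value of \<open>eps\<close> splits the edges in two: those with nonzero value
  correspond to scheme pairs, those with value 0 to pairs of mutually inverse arcs.\<close>

lemma graph_iso_to_arc: "graph_iso G (truncation cycle_graph cycle_scheme) to_arc"
proof -
  have "{u, v} \<in> edges G \<longleftrightarrow> {to_arc u, to_arc v} \<in> edges (truncation cycle_graph cycle_scheme)"
    if uv: "u \<in> verts G" "v \<in> verts G" for u v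
  proof -
    let ?adj = "\<lambda>s t. (s, t) \<in> cycle_scheme \<or> t = arc_inv cycle_graph s"
    have adj: "?adj (to_arc x) (to_arc y) \<longleftrightarrow> {x, y} \<in> edges G"
      if "x \<in> verts G" "y \<in> verts G" for x y
      using that cycle_scheme_iff arc_inv_iff by blast
    have "{to_arc u, to_arc v} \<in> edges (truncation cycle_graph cycle_scheme)
      \<longleftrightarrow> ?adj (to_arc u) (to_arc v) \<or> ?adj (to_arc v) (to_arc u)"
      using uv unfolding truncation_edge_iff arcs_cycle_graph by blast
    then show ?thesis using adj uv by (simp add: insert_commute)
  qed
  moreover have "bij_betw to_arc (verts G) (verts (truncation cycle_graph cycle_scheme))"
    using inj_to_arc by (simp add: bij_betw_def truncation_def arcs_cycle_graph)
  ultimately show ?thesis by (simp add: graph_iso_def)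
qed

section \<open>Automorphisms act on the multigraph of girth cycles\<close>

context
  fixes h :: "'a \<Rightarrow> 'a"
  assumes h: "graph_iso G G h"
begin

lemma h_bij: "inj_on h (verts G)" "h ` verts G = verts G"
  using h by (auto simp: graph_iso_def bij_betw_def)

text \<open>An automorphism carries a girth cycle through \<open>e\<close> to one through the image
  of \<open>e\<close>. The other direction is the same argument for the inverse
  automorphism.\<close>

lemma h_eps:
  assumes "e \<in> edges G"
  shows "eps G (h ` e) = 0 \<longleftrightarrow> eps G e = 0"
proof -
  let ?k = "inv_into (verts G) h"
  have he: "h ` e \<in> edges G" using graph_iso_image_edge simple h assms by blast
  \<comment> \<open>Stated for an arbitrary automorphism \<open>f\<close>, since it is applied both
    to \<open>h\<close> and to its inverse.\<close>
  have mono: "eps G (f ` d) \<noteq> 0" if iso: "graph_iso G G f" and d: "d \<in> edges G" "eps G d \<noteq> 0" for f d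
  proof -
    obtain C where "girth_cycle G C" "d \<in> C" using eps_0_iff[OF d(1)] d(2) by auto
    then have "girth_cycle G ((`) f ` C)" "f ` d \<in> (`) f ` C"
      using girth_cycle_image[OF simple iso] by blast+
    then show ?thesis using eps_0_iff[OF graph_iso_image_edge[OF simple iso d(1)]] by auto
  qed
  have "?k ` h ` e = e"
    using edgeD[OF assms] h_bij(1) by (intro inv_into_image_cancel) auto
  then show ?thesis using mono[OF h assms] mono[OF graph_iso_inv[OF h] he] by metis
qed

lemma h_cyc:
  assumes "v \<in> verts G"
  shows "cyc (h v) = h ` cyc v"
proof -
  have "girth_cycle G ((`) h ` girth_at v)" "h v \<in> \<Union> ((`) h ` girth_at v)"
    using girth_cycle_image[OF simple h] girth_at[OF assms] by auto
  then have "girth_at (h v) = (`) h ` girth_at v" by (rule girth_at_eq)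
  then show ?thesis by (auto simp: cyc_def)
qed

lemma h_spoke:
  assumes "v \<in> verts G"
  shows "spoke (h v) = h ` spoke v"
  using spoke[OF assms] graph_iso_image_edge[OF simple h] h_eps by (intro spoke_eq) auto

text \<open>The induced action takes images of the edge and of the tail and keeps the tag. As it
  commutes with \<open>to_arc\<close>, claims about arcs reduce to claims about vertices.\<close>

lemma h_to_arc: "v \<in> verts G \<Longrightarrow> map_prod ((`) h) (map_prod ((`) h) id) (to_arc v) = to_arc (h v)"
  by (simp add: to_arc_def h_cyc h_spoke)

lemma h_edge_iff: "u \<in> verts G \<Longrightarrow> v \<in> verts G \<Longrightarrow> {h u, h v} \<in> edges G \<longleftrightarrow> {u, v} \<in> edges G"
  using h by (simp add: graph_iso_def)

lemma multigraph_aut_image: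
  "multigraph_aut cycle_graph ((`) h) ((`) h) (map_prod ((`) h) (map_prod ((`) h) id))"
  (is "multigraph_aut _ _ _ ?\<alpha>")
proof -
  have injP: "inj_on ((`) h) (Pow (verts G))" using h_bij(1) by (rule inj_on_image_Pow)
  have hv: "h v \<in> verts G" if "v \<in> verts G" for v using that h_bij by blast
  have "bij_betw ((`) h) (mverts cycle_graph) (mverts cycle_graph)"
  proof (rule bij_betw_imageI)
    show "inj_on ((`) h) (mverts cycle_graph)"
      using cyc_subset by (intro inj_on_subset[OF injP]) (auto simp: cycle_graph_def)
    have "(`) h ` cyc ` verts G = cyc ` h ` verts G"
      by (simp add: image_image h_cyc cong: image_cong_simp)
    then show "(`) h ` mverts cycle_graph = mverts cycle_graph"
      by (simp add: cycle_graph_def h_bij)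
  qed
  moreover have "bij_betw ((`) h) (medges cycle_graph) (medges cycle_graph)"
  proof (rule bij_betw_imageI)
    show "inj_on ((`) h) (medges cycle_graph)"
      using edgeD by (intro inj_on_subset[OF injP]) (auto simp: cycle_graph_def)
    have "e \<in> (`) h ` medges cycle_graph" if e: "e \<in> medges cycle_graph" for e
    proof -
      \<comment> \<open>For surjectivity the preimage must again be a spoke: the inverse
        automorphism makes it an edge, and \<open>h_eps\<close> gives it value 0.\<close>
      let ?d = "inv_into (verts G) h ` e"
      have "e \<in> edges G" "eps G e = 0" using e by (auto simp: cycle_graph_def)
      moreover from this have "h ` ?d = e"
        using edgeD h_bij(2) by (intro image_inv_into_cancel) auto
      moreover have "?d \<in> edges G"
        using graph_iso_image_edge[OF simple graph_iso_inv[OF h]] \<open>e \<in> edges G\<close> by blast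
      ultimately have "?d \<in> medges cycle_graph" using h_eps[of ?d] by (simp add: cycle_graph_def)
      then show ?thesis using \<open>h ` ?d = e\<close> by (metis imageI)
    qed
    moreover have "(`) h ` medges cycle_graph \<subseteq> medges cycle_graph"
      using graph_iso_image_edge[OF simple h] h_eps by (auto simp: cycle_graph_def)
    ultimately show "(`) h ` medges cycle_graph = medges cycle_graph" by blast
  qed
  moreover have "bij_betw ?\<alpha> (arcs cycle_graph) (arcs cycle_graph)"
  proof (rule bij_betw_imageI)
    show "inj_on ?\<alpha> (arcs cycle_graph)"
      using h_bij(1) hv by (auto simp: arcs_cycle_graph inj_on_def h_to_arc to_arc_eq_iff)
    have "?\<alpha> ` to_arc ` verts G = to_arc ` h ` verts G"
      by (simp add: image_image h_to_arc cong: image_cong_simp)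
    then show "?\<alpha> ` arcs cycle_graph = arcs cycle_graph"
      by (simp add: arcs_cycle_graph h_bij)
  qed
  moreover have "ends cycle_graph (h ` e) = (`) h ` ends cycle_graph e"
    if "e \<in> medges cycle_graph" for e
  proof -
    have "e \<subseteq> verts G" using that edgeD by (auto simp: cycle_graph_def)
    then have "cyc (h v) = h ` cyc v" if "v \<in> e" for v using that h_cyc by blast
    then show ?thesis by (simp add: cycle_graph_def image_image cong: image_cong_simp)
  qed
  moreover have "?\<alpha> (arc_inv cycle_graph (to_arc u)) = arc_inv cycle_graph (?\<alpha> (to_arc u))"
    if u: "u \<in> verts G" for u
  proof -
    obtain v where "spoke u = {u, v}" using spoke[OF u] by (metis edge_other)
    then have uv: "{u, v} \<in> edges G" "eps G {u, v} = 0" using spoke[OF u] by auto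
    then have "v \<in> verts G" using edge_verts by blast
    moreover have "{h u, h v} \<in> edges G" "eps G {h u, h v} = 0"
      using uv graph_iso_image_edge[OF simple h uv(1)] h_eps[OF uv(1)] by auto
    ultimately show ?thesis using u uv by (simp add: arc_inv_to_arc h_to_arc)
  qed
  ultimately show ?thesis
    by (auto simp: multigraph_aut_def arcs_cycle_graph) (auto simp: to_arc_def arc_edge_def arc_tail_def)
qed

lemma cycle_scheme_image:
  assumes "u \<in> verts G" "v \<in> verts G"
  shows "(to_arc (h u), to_arc (h v)) \<in> cycle_scheme \<longleftrightarrow> (to_arc u, to_arc v) \<in> cycle_scheme"
proof -
  have "h u \<in> verts G" "h v \<in> verts G" using assms h_bij by auto
  then show ?thesis using assms h_edge_iff h_eps[of "{u, v}"] by (auto simp: cycle_scheme_iff)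
qed

end

text \<open>Arcs correspond to vertices of \<open>G\<close>, so an automorphism taking
  \<open>u\<close> to \<open>v\<close> induces one of the multigraph taking \<open>to_arc u\<close>
  to \<open>to_arc v\<close>. It respects the scheme because it preserves edges and whether
  \<open>eps\<close> vanishes.\<close>

lemma arc_transitive_cycle_scheme:
  assumes "vertex_transitive G"
  shows "arc_transitive_scheme cycle_graph cycle_scheme"
  unfolding arc_transitive_scheme_def
proof (intro ballI)
  fix s t assume "s \<in> arcs cycle_graph" "t \<in> arcs cycle_graph"
  then obtain u v where uv: "u \<in> verts G" "v \<in> verts G" "s = to_arc u" "t = to_arc v"
    by (auto simp: arcs_cycle_graph)
  then obtain h where h: "graph_iso G G h" "h u = v" using assms by (auto simp: vertex_transitive_def)
  let ?\<alpha> = "map_prod ((`) h) (map_prod ((`) h) id)"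
  have scheme: "(a, b) \<in> cycle_scheme \<longleftrightarrow> (?\<alpha> a, ?\<alpha> b) \<in> cycle_scheme"
    if ab: "a \<in> arcs cycle_graph" "b \<in> arcs cycle_graph" for a b
  proof -
    obtain x y where "a = to_arc x" "b = to_arc y" "x \<in> verts G" "y \<in> verts G"
      using ab unfolding arcs_cycle_graph by blast
    then show ?thesis by (simp only: h_to_arc[OF h(1)] cycle_scheme_image[OF h(1)])
  qed
  have st: "?\<alpha> s = t" using h_to_arc[OF h(1)] uv h(2) by simp
  show "\<exists>\<phi> \<psi> \<alpha>. multigraph_aut cycle_graph \<phi> \<psi> \<alpha> \<and>
      (\<forall>a\<in>arcs cycle_graph. \<forall>b\<in>arcs cycle_graph.
        (a, b) \<in> cycle_scheme \<longleftrightarrow> (\<alpha> a, \<alpha> b) \<in> cycle_scheme) \<and> \<alpha> s = t"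
  proof (rule exI, rule exI, rule exI, rule conjI)
    show "multigraph_aut cycle_graph ((`) h) ((`) h) ?\<alpha>"
      by (rule multigraph_aut_image[OF h(1)])
    show "(\<forall>a\<in>arcs cycle_graph. \<forall>b\<in>arcs cycle_graph.
        (a, b) \<in> cycle_scheme \<longleftrightarrow> (?\<alpha> a, ?\<alpha> b) \<in> cycle_scheme) \<and> ?\<alpha> s = t"
      by (intro conjI ballI scheme st)
  qed
qed

end

theorem theorem3p6:
  fixes \<Gamma> :: "'a sgraph" and g :: nat
  assumes "simple_graph \<Gamma>"
    and "cubic \<Gamma>"
    and "girth_regular \<Gamma>"
    and "girth \<Gamma> = enat g"
    and "has_signature \<Gamma> [0, 1, 1]"
  shows "\<exists>(\<Lambda> :: ('a set, 'a set) multigraph) R.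
           multigraph \<Lambda> \<and> loopless \<Lambda> \<and> mregular g \<Lambda> \<and>
           dihedral_scheme \<Lambda> R \<and>
           isomorphic \<Gamma> (truncation \<Lambda> R) \<and>
           (vertex_transitive \<Gamma> \<longrightarrow> arc_transitive_scheme \<Lambda> R)"
proof -
  interpret signature_011 \<Gamma> g
    using assms by unfold_locales
  show ?thesis
    using multigraph_cycle_graph loopless_cycle_graph mregular_cycle_graph dihedral_cycle_scheme
      graph_iso_to_arc arc_transitive_cycle_scheme
    unfolding isomorphic_def by blast
qed

end
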